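(* Let $T\in TQ$ be such that the induced cylinder map $\widehat T$ is $\mu$-exact (for some measure $\mu$ as in the context). Suppose $\overline T$ has a periodic orbit with vertical rotation number $\rho_V=\frac{k}{N}$, where $k\in\mathbb{Z}$, $k\ne0$, and $N\ge1$ is an integer. Then for every pair $(k',N')$ with $k'\in\mathbb{Z}$, $k'\neq0$, and $N'\geq1$ an integer, such that $0<\left|\frac{k'}{N'}\right|<\left|\frac{k}{N}\right|$ and $k\cdot k'>0$, the map $\overline T$ has at least two periodic orbits with vertical rotation number $\frac{k'}{N'}$.
   Context: Write $S^1=\mathbb{R}/\mathbb{Z}$, $\mathbb{T}^2=\mathbb{R}^2/\mathbb{Z}^2$, let $p:\mathbb{R}^2\to\mathbb{T}^2$ be the covering map, and $p_1(\phi,I)=\phi$, $p_2(\phi,I)=I$ the projections (on the plane or on the cylinder $S^1\times\mathbb{R}$). The set $TQ$: the set of all $C^1$ diffeomorphisms $T=(T_\phi,T_I):\mathbb{R}^2\to\mathbb{R}^2$, $(\phi,I)\mapsto(T_\phi(\phi,I),T_I(\phi,I))$, that are lifts of $C^1$ diffeomorphisms of the cylinder $S^1\times\mathbb{R}$ and satisfy: $\partial_I T_\phi(\phi,I)>0$ everywhere (twist to the right); $T_I(\phi,I)\to\pm\infty$ and $T_\phi(\phi,I)\to\pm\infty$ as $I\to\pm\infty$; and for all $(\phi,I)$: $T_I(\phi+1,I)=T_I(\phi,I)$, $T_I(\phi,I+1)=T_I(\phi,I)+1$, $T_\phi(\phi+1,I)=T_\phi(\phi,I)+1$, $T_\phi(\phi,I+1)=T_\phi(\phi,I)+1$.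 Each $T\in TQ$ induces a diffeomorphism $\widehat T$ of $S^1\times\mathbb{R}$ and a diffeomorphism $\overline T$ of $\mathbb{T}^2$. $\mu$-exactness: let $\mu$ be a measure on $S^1\times\mathbb{R}$ that is positive on (nonempty) open sets and absolutely continuous with respect to Lebesgue measure. $\widehat T$ is $\mu$-exact if $\mu$ is $\widehat T$-invariant and for every open set $A\subset S^1\times\mathbb{R}$ homeomorphic to the cylinder, $\mu(\widehat T(A)\setminus A)=\mu(A\setminus\widehat T(A))$. Vertical rotation number: for $x\in\mathbb{T}^2$ and any $\tilde x\in p^{-1}(x)$, $\rho_V(x)=\lim_{n\to\infty}\frac{p_2(T^n(\tilde x))-p_2(\tilde x)}{n}$ if the limit exists (it does not depend on the choice of $\tilde x$). For a periodic orbit $O$ of $\overline T$ (the finite orbit $\{x,\overline T(x),\dots,\overline T^{n-1}(x)\}$ of a point with $\overline T^n(x)=x$, $n\ge1$ minimal), $\rho_V(O)=\rho_V(x)$ for any $x\in O$. *)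

theory Defs
  imports "HOL-Analysis.Analysis"
begin

quotient_type circle = real / "\<lambda>x y :: real. x - y \<in> \<int>"
  morphisms rep_circle circle_of
proof (rule equivpI)
  show "reflp (\<lambda>x y :: real. x - y \<in> \<int>)"
    by (simp add: reflp_def)
  show "symp (\<lambda>x y :: real. x - y \<in> \<int>)"
  proof (rule sympI)
    show "y - x \<in> \<int>" if "x - y \<in> \<int>" for x y :: real
      using Ints_minus[OF that] by simp
  qed
  show "transp (\<lambda>x y :: real. x - y \<in> \<int>)"
  proof (rule transpI)
    show "x - z \<in> \<int>" if "x - y \<in> \<int>" "y - z \<in> \<int>" for x y z :: real
      using Ints_add[OF that] by simp
  qed
qed

text \<open>The circle carries the quotient topology; the cylinder \<open>circle \<times> real\<close> and the torus
  \<open>circle \<times> circle\<close> carry the library's product topologies.\<close>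

instantiation circle :: topological_space
begin

definition open_circle :: "circle set \<Rightarrow> bool"
  where "open_circle U \<longleftrightarrow> open (circle_of -` U)"

instance
proof
  show "open (UNIV :: circle set)"
    by (simp add: open_circle_def)
  show "open (S \<inter> U)" if "open S" "open U" for S U :: "circle set"
    using that by (simp add: open_circle_def open_Int)
  show "open (\<Union>K)" if "\<forall>S\<in>K. open S" for K :: "circle set set"
    using that by (simp add: open_circle_def vimage_Union open_UN)
qed

end

definition cyl_proj :: "real \<times> real \<Rightarrow> circle \<times> real"
  where "cyl_proj = (\<lambda>(\<phi>, I). (circle_of \<phi>, I))"

definition torus_proj :: "real \<times> real \<Rightarrow> circle \<times> circle"
  where "torus_proj = (\<lambda>(\<phi>, I). (circle_of \<phi>, circle_of I))"

lemma circle_of_eq_iff: "circle_of x = circle_of y \<longleftrightarrow> x - y \<in> \<int>"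
  by (rule circle.abs_eq_iff)

lemma surj_circle_of: "surj circle_of"
  by (metis Quotient3_abs_rep Quotient3_circle surjI)

lemma surj_cyl_proj: "surj cyl_proj"
proof -
  have "\<exists>z. y = cyl_proj z" for y
    using surjD[OF surj_circle_of, of "fst y"] by (cases y) (auto simp: cyl_proj_def)
  then show ?thesis by (auto simp: surj_def)
qed

lemma surj_torus_proj: "surj torus_proj"
proof -
  have "\<exists>z. y = torus_proj z" for y
    using surjD[OF surj_circle_of, of "fst y"] surjD[OF surj_circle_of, of "snd y"]
    by (cases y) (auto simp: torus_proj_def)
  then show ?thesis by (auto simp: surj_def)
qed

lemma continuous_on_circle_of: "continuous_on A circle_of"
  by (rule continuous_on_subset[of UNIV])
     (auto simp: continuous_on_open_vimage open_circle_def)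

lemma continuous_on_cyl_proj: "continuous_on A cyl_proj"
  unfolding cyl_proj_def case_prod_unfold
  by (intro continuous_intros continuous_on_compose2[OF continuous_on_circle_of[of UNIV]]) auto

definition C1_on :: "(real \<times> real) set \<Rightarrow> (real \<times> real \<Rightarrow> real \<times> real) \<Rightarrow> bool"
  where "C1_on U f \<longleftrightarrow>
    (\<exists>f' :: real \<times> real \<Rightarrow> (real \<times> real) \<Rightarrow>\<^sub>L (real \<times> real).
      (\<forall>z\<in>U. (f has_derivative blinfun_apply (f' z)) (at z)) \<and> continuous_on U f')"

definition C1_diffeo_plane :: "(real \<times> real \<Rightarrow> real \<times> real) \<Rightarrow> bool"
  where "C1_diffeo_plane f \<longleftrightarrow> bij f \<and> C1_on UNIV f \<and> C1_on UNIV (inv f)"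

text \<open>The local inverses of \<open>cyl_proj\<close> are the charts of the cylinder, so \<open>F\<close> is \<open>C\<^sup>1\<close> iff near
  every point it is represented by a \<open>C\<^sup>1\<close> map \<open>f\<close> between open sets of the plane.\<close>

definition C1_cyl :: "(circle \<times> real \<Rightarrow> circle \<times> real) \<Rightarrow> bool"
  where "C1_cyl F \<longleftrightarrow>
    (\<forall>z. \<exists>U f. open U \<and> z \<in> U \<and> C1_on U f \<and> (\<forall>w\<in>U. cyl_proj (f w) = F (cyl_proj w)))"

definition C1_diffeo_cyl :: "(circle \<times> real \<Rightarrow> circle \<times> real) \<Rightarrow> bool"
  where "C1_diffeo_cyl F \<longleftrightarrow> bij F \<and> C1_cyl F \<and> C1_cyl (inv F)"

definition is_lift :: "('a \<Rightarrow> 'b) \<Rightarrow> ('a \<Rightarrow> 'a) \<Rightarrow> ('b \<Rightarrow> 'b) \<Rightarrow> bool"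
  where "is_lift \<pi> T F \<longleftrightarrow> (\<forall>z. \<pi> (T z) = F (\<pi> z))"

text \<open>The preimage chosen by \<open>inv \<pi>\<close> is irrelevant as soon as \<open>T\<close> is a lift of some map; see
  \<open>induced_eq\<close>.\<close>

definition induced :: "('a \<Rightarrow> 'b) \<Rightarrow> ('a \<Rightarrow> 'a) \<Rightarrow> 'b \<Rightarrow> 'b"
  where "induced \<pi> T = (\<lambda>x. \<pi> (T (inv \<pi> x)))"

lemma induced_eq: "surj \<pi> \<Longrightarrow> is_lift \<pi> T F \<Longrightarrow> induced \<pi> T = F"
  by (auto simp: induced_def is_lift_def surj_f_inv_f)

abbreviation cyl_map :: "(real \<times> real \<Rightarrow> real \<times> real) \<Rightarrow> circle \<times> real \<Rightarrow> circle \<times> real"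
  where "cyl_map \<equiv> induced cyl_proj"

abbreviation torus_map :: "(real \<times> real \<Rightarrow> real \<times> real) \<Rightarrow> circle \<times> circle \<Rightarrow> circle \<times> circle"
  where "torus_map \<equiv> induced torus_proj"

definition TQ :: "(real \<times> real \<Rightarrow> real \<times> real) set"
  where "TQ = {T.
    C1_diffeo_plane T \<and>
    (\<exists>F. C1_diffeo_cyl F \<and> is_lift cyl_proj T F) \<and>
    (\<forall>\<phi> I. deriv (\<lambda>t. fst (T (\<phi>, t))) I > 0) \<and>
    (\<forall>\<phi>. filterlim (\<lambda>I. snd (T (\<phi>, I))) at_top at_top \<and>
          filterlim (\<lambda>I. snd (T (\<phi>, I))) at_bot at_bot \<and>
          filterlim (\<lambda>I. fst (T (\<phi>, I))) at_top at_top \<and>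
          filterlim (\<lambda>I. fst (T (\<phi>, I))) at_bot at_bot) \<and>
    (\<forall>\<phi> I. snd (T (\<phi> + 1, I)) = snd (T (\<phi>, I)) \<and>
            snd (T (\<phi>, I + 1)) = snd (T (\<phi>, I)) + 1 \<and>
            fst (T (\<phi> + 1, I)) = fst (T (\<phi>, I)) + 1 \<and>
            fst (T (\<phi>, I + 1)) = fst (T (\<phi>, I)) + 1)}"

lemma TQ_periodic:
  assumes "T \<in> TQ"
  shows "snd (T (\<phi> + of_int m, I + of_int n)) = snd (T (\<phi>, I)) + of_int n"
    and "fst (T (\<phi> + of_int m, I + of_int n)) = fst (T (\<phi>, I)) + of_int m + of_int n"
proof -
  have per: "snd (T (\<phi> + 1, I)) = snd (T (\<phi>, I))" "snd (T (\<phi>, I + 1)) = snd (T (\<phi>, I)) + 1"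
    "fst (T (\<phi> + 1, I)) = fst (T (\<phi>, I)) + 1" "fst (T (\<phi>, I + 1)) = fst (T (\<phi>, I)) + 1" for \<phi> I
    using assms by (auto simp: TQ_def)
  have h: "snd (T (\<phi> + of_int m, I)) = snd (T (\<phi>, I)) \<and>
      fst (T (\<phi> + of_int m, I)) = fst (T (\<phi>, I)) + of_int m" for \<phi> I
  proof (induction m rule: int_induct[where k = 0])
    case (step1 i)
    then show ?case using per(1,3)[of "\<phi> + of_int i" I] by (simp add: add.assoc)
  next
    case (step2 i)
    then show ?case using per(1,3)[of "\<phi> + of_int (i - 1)" I] by (simp add: algebra_simps)
  qed simp
  have v: "snd (T (\<phi>, I + of_int n)) = snd (T (\<phi>, I)) + of_int n \<and>
      fst (T (\<phi>, I + of_int n)) = fst (T (\<phi>, I)) + of_int n" for \<phi> I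
  proof (induction n rule: int_induct[where k = 0])
    case (step1 i)
    then show ?case using per(2,4)[of \<phi> "I + of_int i"] by (simp add: add.assoc)
  next
    case (step2 i)
    then show ?case using per(2,4)[of \<phi> "I + of_int (i - 1)"] by (simp add: algebra_simps)
  qed simp
  show "snd (T (\<phi> + of_int m, I + of_int n)) = snd (T (\<phi>, I)) + of_int n"
    using h[of \<phi> "I + of_int n"] v[of \<phi> I] by simp
  show "fst (T (\<phi> + of_int m, I + of_int n)) = fst (T (\<phi>, I)) + of_int m + of_int n"
    using h[of \<phi> "I + of_int n"] v[of \<phi> I] by simp
qed

lemma TQ_is_lift_torus_map:
  assumes "T \<in> TQ"
  shows "is_lift torus_proj T (torus_map T)"
  unfolding is_lift_def
proof
  fix z :: "real \<times> real"
  define w where "w = inv torus_proj (torus_proj z)"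
  have "torus_proj w = torus_proj z"
    unfolding w_def by (rule surj_f_inv_f[OF surj_torus_proj])
  then have "fst w - fst z \<in> \<int>" "snd w - snd z \<in> \<int>"
    by (auto simp: torus_proj_def case_prod_unfold circle_of_eq_iff)
  then obtain m n where "fst w - fst z = of_int m" "snd w - snd z = of_int n"
    by (auto elim!: Ints_cases)
  then have "w = (fst z + of_int m, snd z + of_int n)"
    by (simp add: prod_eq_iff)
  then have "torus_proj (T w) = torus_proj (T z)"
    using TQ_periodic[OF assms, of "fst z" m "snd z" n]
    by (simp add: torus_proj_def case_prod_unfold circle_of_eq_iff)
  then show "torus_proj (T z) = torus_map T (torus_proj z)"
    by (simp add: induced_def w_def)
qed

lemma TQ_is_lift_cyl_map: "T \<in> TQ \<Longrightarrow> is_lift cyl_proj T (cyl_map T)"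
  unfolding TQ_def using induced_eq[OF surj_cyl_proj] by blast

text \<open>Lebesgue measure on the cylinder is the image of planar Lebesgue measure on the fundamental
  domain \<open>[0,1) \<times> \<real>\<close>.\<close>

definition cyl_lebesgue :: "(circle \<times> real) measure"
  where "cyl_lebesgue = distr (restrict_space lborel ({0..<1} \<times> UNIV)) borel cyl_proj"

lemma measurable_cyl_proj: "cyl_proj \<in> restrict_space lborel S \<rightarrow>\<^sub>M borel"
  using borel_measurable_continuous_onI[OF continuous_on_cyl_proj]
  by (intro measurable_restrict_space1) simp

definition positive_ac_measure :: "(circle \<times> real) measure \<Rightarrow> bool"
  where "positive_ac_measure \<mu> \<longleftrightarrow>
    sets \<mu> = sets borel \<and>
    (\<forall>U. open U \<longrightarrow> U \<noteq> {} \<longrightarrow> emeasure \<mu> U > 0) \<and>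
    absolutely_continuous cyl_lebesgue \<mu>"

definition mu_exact :: "(circle \<times> real) measure \<Rightarrow> (circle \<times> real \<Rightarrow> circle \<times> real) \<Rightarrow> bool"
  where "mu_exact \<mu> F \<longleftrightarrow>
    F \<in> measurable \<mu> \<mu> \<and> distr \<mu> \<mu> F = \<mu> \<and>
    (\<forall>A. open A \<longrightarrow> A homeomorphic (UNIV :: (circle \<times> real) set) \<longrightarrow>
      emeasure \<mu> (F ` A - A) = emeasure \<mu> (A - F ` A))"

definition periodic_orbit :: "('a \<Rightarrow> 'a) \<Rightarrow> 'a set \<Rightarrow> bool"
  where "periodic_orbit f Q \<longleftrightarrow>
    (\<exists>x n. n \<ge> 1 \<and> (f ^^ n) x = x \<and> (\<forall>m. 1 \<le> m \<and> m < n \<longrightarrow> (f ^^ m) x \<noteq> x) \<and>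
      Q = (\<lambda>i. (f ^^ i) x) ` {..<n})"

definition has_vertical_rotation_number ::
    "(real \<times> real \<Rightarrow> real \<times> real) \<Rightarrow> circle \<times> circle \<Rightarrow> real \<Rightarrow> bool"
  where "has_vertical_rotation_number T x \<rho> \<longleftrightarrow>
    (\<forall>z. torus_proj z = x \<longrightarrow> (\<lambda>n. (snd ((T ^^ n) z) - snd z) / real n) \<longlonglongrightarrow> \<rho>)"

definition orbit_has_vertical_rotation_number ::
    "(real \<times> real \<Rightarrow> real \<times> real) \<Rightarrow> (circle \<times> circle) set \<Rightarrow> real \<Rightarrow> bool"
  where "orbit_has_vertical_rotation_number T Q \<rho> \<longleftrightarrow>
    (\<forall>x\<in>Q. has_vertical_rotation_number T x \<rho>)"

end

theory Submission
  imports Defs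
begin

text \<open>By the twist condition an orbit is determined by its sequence of angles \<open>x\<^sub>i\<close>, and the angle
  sequences of orbits are the zeros of a defect \<open>D x\<^bsub>i-1\<^esub> x\<^sub>i x\<^bsub>i+1\<^esub>\<close> that is increasing in its outer
  arguments and, up to a function periodic in all arguments, equal to the second difference. Points
  with \<open>T\<^sup>N z = z + (s, k)\<close> correspond to zeros with \<open>x\<^bsub>i+N\<^esub> = x\<^sub>i + s + i k\<close>, which grow like a parabola
  of curvature \<open>k / N\<close>. A zero of larger curvature lies, after adding an integer, above such a
  parabola, and one of smaller curvature below it, so Perron's method of sub- and supersolutions
  yields a zero for every curvature in between. Exactness provides curvature \<open>0\<close>: the graph
  of those points whose angle is fixed by \<open>T\<close> must meet its image. Two different orbits
  are obtained because \<open>s\<close> is arbitrary.\<close>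

subsection \<open>Quasi-quadratic sequences\<close>

text \<open>The linear term reflects that raising a point by \<open>m\<close> shifts its angle by
  \<open>m\<close> at each application of \<open>T\<close>.\<close>

definition quasi_quadratic :: "nat \<Rightarrow> int \<Rightarrow> int \<Rightarrow> (int \<Rightarrow> real) \<Rightarrow> bool"
  where "quasi_quadratic n s m u \<longleftrightarrow> (\<forall>i. u (i + int n) = u i + of_int s + of_int i * of_int m)"

text \<open>The second difference is the constant \<open>m / n\<close>; the linear coefficient is
  fixed by the increment \<open>s\<close> from \<open>0\<close> to \<open>n\<close>.\<close>

definition parabola :: "nat \<Rightarrow> int \<Rightarrow> int \<Rightarrow> int \<Rightarrow> real"
  where "parabola n s m i =
    of_int m / (2 * real n) * (of_int i)\<^sup>2 + (of_int s / real n - of_int m / 2) * of_int i"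

lemma quasi_quadratic_parabola: "n > 0 \<Longrightarrow> quasi_quadratic n s m (parabola n s m)"
  by (simp add: quasi_quadratic_def parabola_def field_simps power2_eq_square)

lemma periodic_bounded:
  fixes d :: "int \<Rightarrow> real"
  assumes "n > 0" and per: "\<And>i. d (i + int n) = d i"
  shows "\<exists>C. \<forall>i. \<bar>d i\<bar> \<le> C"
proof -
  have multiple: "d (i + j * int n) = d i" for i j
  proof (induction j rule: int_induct[where k = 0])
    case (step1 j)
    then show ?case using per[of "i + j * int n"] by (simp add: algebra_simps)
  next
    case (step2 j)
    then show ?case using per[of "i + (j - 1) * int n"] by (simp add: algebra_simps)
  qed simp
  have "d i = d (i mod int n)" for i
    using multiple[of "i mod int n" "i div int n"] by (simp add: algebra_simps)
  moreover have "\<bar>d (i mod int n)\<bar> \<le> Max ((\<lambda>i. \<bar>d i\<bar>) ` {0..<int n})" for i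
    using \<open>n > 0\<close> by (intro Max_ge) auto
  ultimately show ?thesis by metis
qed

text \<open>Subtracting the parabola with the same parameters cancels the increments over
  \<open>n\<close> steps and leaves a periodic sequence.\<close>

lemma quasi_quadratic_near_parabola:
  assumes "n > 0" and u: "quasi_quadratic n s m u"
  shows "\<exists>C. \<forall>i. \<bar>u i - parabola n s m i\<bar> \<le> C"
proof (rule periodic_bounded[OF \<open>n > 0\<close>])
  show "u (i + int n) - parabola n s m (i + int n) = u i - parabola n s m i" for i
    using u quasi_quadratic_parabola[OF \<open>n > 0\<close>, of s m] by (simp add: quasi_quadratic_def)
qed

text \<open>The difference of the parabolas is a quadratic polynomial with leading coefficient
  \<open>a > 0\<close>; completing the square bounds it below.\<close>

lemma parabola_le:
  assumes less: "of_int m / real n < of_int m' / real n'"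
  shows "\<exists>C. \<forall>i. parabola n s m i \<le> parabola n' s' m' i + C"
proof -
  define a where "a = of_int m' / (2 * real n') - of_int m / (2 * real n)"
  define b where "b = (of_int s' / real n' - of_int m' / 2) - (of_int s / real n - of_int m / 2)"
  have "a > 0" using less by (simp add: a_def)
  have "parabola n s m i \<le> parabola n' s' m' i + b\<^sup>2 / (4 * a)" for i
  proof -
    have "a * (of_int i)\<^sup>2 + b * of_int i + b\<^sup>2 / (4 * a) = a * (of_int i + b / (2 * a))\<^sup>2"
      using \<open>a > 0\<close> by (simp add: field_simps power2_eq_square)
    also have "\<dots> \<ge> 0" using \<open>a > 0\<close> by simp
    finally show ?thesis by (simp add: parabola_def a_def b_def algebra_simps)
  qed
  then show ?thesis by blast
qed

text \<open>The constant is rounded up to an integer so that adding it maps solutions of the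
  recurrence to solutions.\<close>

lemma quasi_quadratic_le:
  assumes "n > 0" "n' > 0" and u: "quasi_quadratic n s m u" and v: "quasi_quadratic n' s' m' v"
    and less: "of_int m / real n < of_int m' / real n'"
  obtains K :: int where "\<And>i. u i \<le> v i + of_int K"
proof -
  obtain A where A: "\<And>i. \<bar>u i - parabola n s m i\<bar> \<le> A"
    using quasi_quadratic_near_parabola[OF \<open>n > 0\<close> u] by blast
  obtain B where B: "\<And>i. \<bar>v i - parabola n' s' m' i\<bar> \<le> B"
    using quasi_quadratic_near_parabola[OF \<open>n' > 0\<close> v] by blast
  obtain C where C: "\<And>i. parabola n s m i \<le> parabola n' s' m' i + C"
    using parabola_le[OF less] by blast
  have "u i \<le> v i + of_int \<lceil>A + B + C\<rceil>" for i
    using A[of i] B[of i] C[of i] le_of_int_ceiling[of "A + B + C"] by linarith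
  then show ?thesis by (rule that)
qed

subsection \<open>Perron's method for monotone recurrences\<close>

locale monotone_recurrence =
  fixes D :: "real \<Rightarrow> real \<Rightarrow> real \<Rightarrow> real"
  assumes mono: "a \<le> a' \<Longrightarrow> c \<le> c' \<Longrightarrow> D a b c \<le> D a' b c'"
    and cont: "continuous_on UNIV (\<lambda>b. D a b c)"
    and translate: "D (a + of_int p) (b + of_int q) (c + of_int r) = D a b c + of_int (p + r - 2 * q)"
begin

definition subsolution :: "(int \<Rightarrow> real) \<Rightarrow> bool"
  where "subsolution v \<longleftrightarrow> (\<forall>i. D (v (i - 1)) (v i) (v (i + 1)) \<ge> 0)"

definition supersolution :: "(int \<Rightarrow> real) \<Rightarrow> bool"
  where "supersolution v \<longleftrightarrow> (\<forall>i. D (v (i - 1)) (v i) (v (i + 1)) \<le> 0)"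

text \<open>Replacing the neighbours by suprema can only increase \<open>D\<close>. The middle
  values then lie in a set that is closed by continuity in \<open>b\<close> and so contains their
  supremum.\<close>

lemma subsolution_Sup:
  assumes "S \<noteq> {}" and sub: "\<And>v. v \<in> S \<Longrightarrow> subsolution v"
    and bdd: "\<And>i. bdd_above ((\<lambda>v. v i) ` S)"
  shows "subsolution (\<lambda>i. SUP v\<in>S. v i)"
  unfolding subsolution_def
proof
  fix i
  define w where "w = (\<lambda>i. SUP v\<in>S. v i)"
  have upper: "v j \<le> w j" if "v \<in> S" for v j
    unfolding w_def using that bdd by (intro cSUP_upper)
  have "(\<lambda>v. v i) ` S \<subseteq> {b. 0 \<le> D (w (i - 1)) b (w (i + 1))}"
  proof clarify
    fix v assume "v \<in> S"
    then have "0 \<le> D (v (i - 1)) (v i) (v (i + 1))"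
      using sub by (simp add: subsolution_def)
    also have "\<dots> \<le> D (w (i - 1)) (v i) (w (i + 1))"
      by (intro mono upper \<open>v \<in> S\<close>)
    finally show "0 \<le> D (w (i - 1)) (v i) (w (i + 1))" .
  qed
  moreover have "closed {b. 0 \<le> D (w (i - 1)) b (w (i + 1))}"
    by (intro closed_Collect_le continuous_on_const cont)
  ultimately have "Sup ((\<lambda>v. v i) ` S) \<in> {b. 0 \<le> D (w (i - 1)) b (w (i + 1))}"
    using \<open>S \<noteq> {}\<close> bdd by (intro closed_subset_contains_Sup) auto
  then show "0 \<le> D (SUP v\<in>S. v (i - 1)) (SUP v\<in>S. v i) (SUP v\<in>S. v (i + 1))"
    by (simp add: w_def)
qed

text \<open>Changing the sign of arguments and value exchanges sub- and supersolutions, which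
  reduces infima to suprema.\<close>

lemma reflected: "monotone_recurrence (\<lambda>a b c. - D (- a) (- b) (- c))"
proof
  show "- D (- a) (- b) (- c) \<le> - D (- a') (- b) (- c')" if "a \<le> a'" "c \<le> c'" for a a' b c c'
    using that by (simp add: mono)
  show "continuous_on UNIV (\<lambda>b. - D (- a) (- b) (- c))" for a c
    by (intro continuous_on_minus continuous_on_compose2[OF cont[of "- a" "- c"]]
        continuous_on_id subset_UNIV)
  show "- D (- (a + of_int p)) (- (b + of_int q)) (- (c + of_int r)) =
      - D (- a) (- b) (- c) + of_int (p + r - 2 * q)" for a b c p q r
    using translate[of "- a" "- p" "- b" "- q" "- c" "- r"] by simp
qed

lemma supersolution_Inf:
  assumes "S \<noteq> {}" and super: "\<And>v. v \<in> S \<Longrightarrow> supersolution v"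
    and bdd: "\<And>i. bdd_below ((\<lambda>v. v i) ` S)"
  shows "supersolution (\<lambda>i. INF v\<in>S. v i)"
proof -
  interpret r: monotone_recurrence "\<lambda>a b c. - D (- a) (- b) (- c)"
    by (rule reflected)
  have "r.subsolution (\<lambda>i. SUP v\<in>(\<lambda>v i. - v i) ` S. v i)"
  proof (rule r.subsolution_Sup)
    show "bdd_above ((\<lambda>v. v i) ` (\<lambda>v i. - v i) ` S)" for i
      using bdd[of i] unfolding bdd_above_uminus[symmetric] by (simp add: image_image)
  qed (use assms in \<open>auto simp: r.subsolution_def supersolution_def\<close>)
  then show ?thesis
    by (simp add: r.subsolution_def supersolution_def Inf_real_def image_image)
qed

text \<open>The added integers form an arithmetic progression, whose second difference
  vanishes.\<close>

lemma translate_linear: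
  fixes s i k :: int
  shows "D (a + of_int s + (of_int i - 1) * of_int k) (b + of_int s + of_int i * of_int k)
    (c + of_int s + (of_int i + 1) * of_int k) = D a b c"
  using translate[of a "s + (i - 1) * k" b "s + i * k" c "s + (i + 1) * k"]
  by (simp add: algebra_simps)

lemma translate_sequence:
  fixes v :: "int \<Rightarrow> real" and s k n :: int
  defines "v' \<equiv> \<lambda>i. v (i + n) + of_int s + of_int i * of_int k"
  shows "D (v' (i - 1)) (v' i) (v' (i + 1)) = D (v (i + n - 1)) (v (i + n)) (v (i + n + 1))"
  using translate_linear[of "v (i + n - 1)" s i k "v (i + n)" "v (i + n + 1)"]
  by (simp add: v'_def algebra_simps)

text \<open>The sub- and supersolutions competing below need not be quasi-quadratic; the extremal ones
  are, because the class of competitors is invariant under the symmetry that characterises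
  quasi-quadratic sequences.\<close>

lemma solution_between:
  assumes f: "quasi_quadratic N s k f"
    and x: "subsolution x" "\<And>i. x i \<le> f i" and y: "supersolution y" "\<And>i. f i \<le> y i"
  obtains w where "quasi_quadratic N s k w" "\<And>i. D (w (i - 1)) (w i) (w (i + 1)) = 0"
proof -
  \<comment> \<open>\<open>push\<close> and \<open>pull\<close> are mutually inverse, and the
    quasi-quadratic sequences are their fixed points. The summand \<open>- int N * k\<close> in
    \<open>push\<close> compensates for the index being moved back by \<open>N\<close>.\<close>
  define push where "push = (\<lambda>(v :: int \<Rightarrow> real) i. v (i + - int N) + of_int (s - int N * k) + of_int i * of_int k)"
  define pull where "pull = (\<lambda>(v :: int \<Rightarrow> real) i. v (i + int N) + of_int (- s) + of_int i * of_int (- k))"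
  have push_inv: "push v = v" and pull_inv: "pull v = v" if "quasi_quadratic N s k v" for v
  proof -
    show "push v = v"
    proof
      fix i
      show "push v i = v i"
        using that[unfolded quasi_quadratic_def, rule_format, of "i - int N"]
        by (simp add: push_def algebra_simps)
    qed
    show "pull v = v"
      using that by (auto simp: quasi_quadratic_def pull_def)
  qed
  have sub: "subsolution (push v)" "subsolution (pull v)" if "subsolution v" for v
    using that unfolding subsolution_def push_def pull_def translate_sequence by auto
  have super: "supersolution (push v)" "supersolution (pull v)" if "supersolution v" for v
    using that unfolding supersolution_def push_def pull_def translate_sequence by auto
  have mono_push: "push u i \<le> push v i" and mono_pull: "pull u i \<le> pull v i"
    if "\<And>i. u i \<le> v i" for u v i
    using that by (simp_all add: push_def pull_def)

  \<comment> \<open>\<open>Y\<close> will be the least supersolution above \<open>f\<close>.\<close>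
  define A where "A = {v. supersolution v \<and> (\<forall>i. f i \<le> v i)}"
  define Y where "Y = (\<lambda>i. INF v\<in>A. v i)"
  have "y \<in> A" using y by (simp add: A_def)
  then have "A \<noteq> {}" by blast
  have bddA: "bdd_below ((\<lambda>v. v i) ` A)" for i
    by (rule bdd_belowI[of _ "f i"]) (auto simp: A_def)
  have superY: "supersolution Y"
    unfolding Y_def by (rule supersolution_Inf) (use \<open>A \<noteq> {}\<close> bddA in \<open>auto simp: A_def\<close>)
  have fY: "f i \<le> Y i" for i
    unfolding Y_def by (rule cINF_greatest) (use \<open>A \<noteq> {}\<close> in \<open>auto simp: A_def\<close>)
  have Y_le: "Y i \<le> v i" if "v \<in> A" for v i
    unfolding Y_def using that bddA by (intro cINF_lower)
  have closedA: "push v \<in> A" "pull v \<in> A" if "v \<in> A" for v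
    using that super mono_push[of f v] mono_pull[of f v] push_inv[OF f] pull_inv[OF f]
    by (auto simp: A_def)
  \<comment> \<open>Minimality of \<open>Y\<close> against \<open>push v\<close> gives one
    inequality, against \<open>pull v\<close> the other.\<close>
  have quasiY: "quasi_quadratic N s k Y"
    unfolding quasi_quadratic_def
  proof
    fix i
    have "Y (i + int N) - of_int s - of_int i * of_int k \<le> Y i"
      unfolding Y_def[THEN fun_cong, of i]
    proof (rule cINF_greatest[OF \<open>A \<noteq> {}\<close>])
      fix v assume "v \<in> A"
      then show "Y (i + int N) - of_int s - of_int i * of_int k \<le> v i"
        using Y_le[OF closedA(1), of v "i + int N"] by (simp add: push_def algebra_simps)
    qed
    moreover have "Y i + of_int s + of_int i * of_int k \<le> Y (i + int N)"
      unfolding Y_def[THEN fun_cong, of "i + int N"]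
    proof (rule cINF_greatest[OF \<open>A \<noteq> {}\<close>])
      fix v assume "v \<in> A"
      then show "Y i + of_int s + of_int i * of_int k \<le> v (i + int N)"
        using Y_le[OF closedA(2), of v i] by (simp add: pull_def algebra_simps)
    qed
    ultimately show "Y (i + int N) = Y i + of_int s + of_int i * of_int k" by linarith
  qed

  \<comment> \<open>The ceiling is \<open>Y\<close> rather than \<open>f\<close> because where a
    subsolution touches a supersolution from below, monotonicity forces \<open>D\<close> to be
    nonpositive.\<close>
  define B where "B = {v. subsolution v \<and> (\<forall>i. v i \<le> Y i)}"
  define W where "W = (\<lambda>i. SUP v\<in>B. v i)"
  have "x \<in> B" using x fY by (auto simp: B_def intro: order_trans)
  then have "B \<noteq> {}" by blast
  have bddB: "bdd_above ((\<lambda>v. v i) ` B)" for i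
    by (rule bdd_aboveI[of _ "Y i"]) (auto simp: B_def)
  have subW: "subsolution W"
    unfolding W_def by (rule subsolution_Sup) (use \<open>B \<noteq> {}\<close> bddB in \<open>auto simp: B_def\<close>)
  have WY: "W i \<le> Y i" for i
    unfolding W_def by (rule cSUP_least) (use \<open>B \<noteq> {}\<close> in \<open>auto simp: B_def\<close>)
  have le_W: "v i \<le> W i" if "v \<in> B" for v i
    unfolding W_def using that bddB by (intro cSUP_upper)
  have closedB: "push v \<in> B" "pull v \<in> B" if "v \<in> B" for v
    using that sub mono_push[of v Y] mono_pull[of v Y] push_inv[OF quasiY] pull_inv[OF quasiY]
    by (auto simp: B_def)
  have quasiW: "quasi_quadratic N s k W"
    unfolding quasi_quadratic_def
  proof
    fix i
    have "W i \<le> W (i + int N) - of_int s - of_int i * of_int k"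
      unfolding W_def[THEN fun_cong, of i]
    proof (rule cSUP_least[OF \<open>B \<noteq> {}\<close>])
      fix v assume "v \<in> B"
      then show "v i \<le> W (i + int N) - of_int s - of_int i * of_int k"
        using le_W[OF closedB(1), of v "i + int N"] by (simp add: push_def algebra_simps)
    qed
    moreover have "W (i + int N) \<le> W i + of_int s + of_int i * of_int k"
      unfolding W_def[THEN fun_cong, of "i + int N"]
    proof (rule cSUP_least[OF \<open>B \<noteq> {}\<close>])
      fix v assume "v \<in> B"
      then show "v (i + int N) \<le> W i + of_int s + of_int i * of_int k"
        using le_W[OF closedB(2), of v i] by (simp add: pull_def algebra_simps)
    qed
    ultimately show "W (i + int N) = W i + of_int s + of_int i * of_int k" by linarith
  qed

  \<comment> \<open>Where \<open>D\<close> is positive, \<open>W\<close> could be raised at the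
    single index \<open>i\<close>: at the neighbours this only increases an outer argument of
    \<open>D\<close>. That contradicts maximality of \<open>W\<close>.\<close>
  have "D (W (i - 1)) (W i) (W (i + 1)) = 0" for i
  proof (rule ccontr)
    assume "D (W (i - 1)) (W i) (W (i + 1)) \<noteq> 0"
    then have pos: "D (W (i - 1)) (W i) (W (i + 1)) > 0"
      using subW by (simp add: subsolution_def order_less_le)
    have "W i \<noteq> Y i"
    proof
      assume "W i = Y i"
      then have "D (W (i - 1)) (W i) (W (i + 1)) \<le> D (Y (i - 1)) (Y i) (Y (i + 1))"
        by (simp add: mono WY)
      also have "\<dots> \<le> 0" using superY by (simp add: supersolution_def)
      finally show False using pos by simp
    qed
    then have "W i < Y i" using WY[of i] by simp
    have "open {b. 0 < D (W (i - 1)) b (W (i + 1))}"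
      by (intro open_Collect_less continuous_on_const cont)
    then obtain e where "e > 0" and
      e: "\<And>b. dist b (W i) < e \<Longrightarrow> 0 < D (W (i - 1)) b (W (i + 1))"
      using pos unfolding open_dist by fastforce
    \<comment> \<open>Half of \<open>e\<close> keeps the raised value where \<open>D\<close> stays
      positive; the other bound keeps it below \<open>Y\<close>.\<close>
    define d where "d = min (e / 2) (Y i - W i)"
    have d: "0 < d" "d < e" "W i + d \<le> Y i"
      using \<open>e > 0\<close> \<open>W i < Y i\<close> by (auto simp: d_def)
    define V where "V = W(i := W i + d)"
    have WV: "W j \<le> V j" for j using d by (simp add: V_def)
    have "subsolution V"
      unfolding subsolution_def
    proof
      fix j
      show "0 \<le> D (V (j - 1)) (V j) (V (j + 1))"
      proof (cases "j = i")
        case True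
        then show ?thesis
          using e[of "W i + d"] d by (simp add: V_def dist_real_def less_imp_le)
      next
        case False
        have "0 \<le> D (W (j - 1)) (W j) (W (j + 1))"
          using subW by (simp add: subsolution_def)
        also have "\<dots> \<le> D (V (j - 1)) (W j) (V (j + 1))"
          by (intro mono WV)
        finally show ?thesis using False by (simp add: V_def)
      qed
    qed
    then have "V \<in> B" using WY d by (simp add: B_def V_def)
    from le_W[OF this, of i] show False using d by (simp add: V_def)
  qed
  with quasiW show ?thesis by (rule that)
qed

text \<open>A parabola of the intermediate curvature separates integer translates of the two given
  solutions.\<close>

lemma solution_exists:
  assumes "n1 > 0" "n2 > 0" "N > 0"
    and x: "quasi_quadratic n1 s1 m1 x" "\<And>i. D (x (i - 1)) (x i) (x (i + 1)) = 0"
    and y: "quasi_quadratic n2 s2 m2 y" "\<And>i. D (y (i - 1)) (y i) (y (i + 1)) = 0"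
    and less: "of_int m1 / real n1 < of_int k / real N" "of_int k / real N < of_int m2 / real n2"
  obtains w where "quasi_quadratic N s k w" "\<And>i. D (w (i - 1)) (w i) (w (i + 1)) = 0"
proof -
  define f where "f = parabola N s k"
  have f: "quasi_quadratic N s k f"
    unfolding f_def using \<open>N > 0\<close> by (rule quasi_quadratic_parabola)
  obtain K where K: "\<And>i. x i \<le> f i + of_int K"
    using quasi_quadratic_le[OF \<open>n1 > 0\<close> \<open>N > 0\<close> x(1) f less(1)] by blast
  obtain L where L: "\<And>i. f i \<le> y i + of_int L"
    using quasi_quadratic_le[OF \<open>N > 0\<close> \<open>n2 > 0\<close> f y(1) less(2)] by blast
  show ?thesis
  proof (rule solution_between[OF f])
    show "subsolution (\<lambda>i. x i + of_int (- K))"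
      unfolding subsolution_def translate x(2) by simp
    show "supersolution (\<lambda>i. y i + of_int L)"
      unfolding supersolution_def translate y(2) by simp
    show "x i + of_int (- K) \<le> f i" for i using K[of i] by simp
  qed (use L that in auto)
qed

end

subsection \<open>The recurrence of a twist map\<close>

text \<open>By monotonicity in \<open>I\<close>, comparing \<open>G y\<close> with a constant
  \<open>a\<close> amounts to the sign of \<open>F y a\<close>, so continuity in \<open>x\<close>
  for each fixed \<open>I\<close> suffices.\<close>

lemma continuous_on_implicit_root:
  fixes F :: "real \<Rightarrow> real \<Rightarrow> real"
  assumes cont: "\<And>I. continuous_on UNIV (\<lambda>x. F x I)"
    and mono: "\<And>x I J. I < J \<Longrightarrow> F x I < F x J"
    and root: "\<And>x. F x (G x) = 0"
  shows "continuous_on UNIV G"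
proof -
  have "G \<midarrow>x\<rightarrow> G x" for x
  proof (rule order_tendstoI)
    have lim: "(\<lambda>x. F x I) \<midarrow>x\<rightarrow> F x I" for I
      using cont by (simp add: continuous_on_eq_continuous_at isCont_def)
    have less_iff: "a < G y \<longleftrightarrow> F y a < 0" "G y < a \<longleftrightarrow> F y a > 0" for y a
      using mono[of a "G y" y] mono[of "G y" a y] root[of y]
      by (cases a "G y" rule: linorder_cases; simp)+
    show "\<forall>\<^sub>F y in at x. a < G y" if "a < G x" for a
      using order_tendstoD(2)[OF lim[of a], of 0] that by (simp add: less_iff)
    show "\<forall>\<^sub>F y in at x. G y < a" if "G x < a" for a
      using order_tendstoD(1)[OF lim[of a], of 0] that by (simp add: less_iff)
  qed
  then show ?thesis by (simp add: continuous_on_eq_continuous_at isCont_def)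
qed

text \<open>The logarithm of the depth below the graph straightens each fibre to a line. This makes
  the region an admissible test set in \<open>mu_exact\<close>.\<close>

lemma homeomorphic_cylinder_below_graph:
  fixes G :: "circle \<Rightarrow> real"
  assumes G: "continuous_on UNIV G"
  shows "{p. snd p < G (fst p)} homeomorphic (UNIV :: (circle \<times> real) set)"
proof -
  have cont: "continuous_on S (\<lambda>p :: circle \<times> real. G (fst p))" for S
    by (rule continuous_on_compose2[OF G continuous_on_fst[OF continuous_on_id]]) simp
  have "homeomorphism {p. snd p < G (fst p)} UNIV
      (\<lambda>p. (fst p, ln (G (fst p) - snd p))) (\<lambda>p. (fst p, G (fst p) - exp (snd p)))"
    by (rule homeomorphismI) (auto intro!: continuous_intros cont)
  then show ?thesis unfolding homeomorphic_def by blast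
qed

lemma circle_descent:
  assumes g: "continuous_on UNIV g" and periodic: "\<And>\<phi> m. g (\<phi> + of_int m) = g \<phi>"
  obtains G :: "circle \<Rightarrow> real" where "continuous_on UNIV G" "\<And>\<phi>. G (circle_of \<phi>) = g \<phi>"
proof
  define G where "G = (\<lambda>\<theta>. g (inv circle_of \<theta>))"
  show eq: "G (circle_of \<phi>) = g \<phi>" for \<phi>
  proof -
    have "inv circle_of (circle_of \<phi>) - \<phi> \<in> \<int>"
      by (simp flip: circle_of_eq_iff add: surj_f_inv_f surj_circle_of)
    then obtain m where "inv circle_of (circle_of \<phi>) - \<phi> = of_int m" by (rule Ints_cases)
    then show ?thesis using periodic[of \<phi> m] by (simp add: G_def algebra_simps)
  qed
  have "open (G -` B)" if "open B" for B
  proof -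
    have "circle_of -` (G -` B) = g -` B" by (auto simp: eq)
    then show ?thesis
      using g that by (simp add: open_circle_def continuous_on_open_vimage)
  qed
  then show "continuous_on UNIV G" by (simp add: continuous_on_open_vimage)
qed

lemma nonzero_continuous_sign:
  fixes f :: "real \<Rightarrow> real"
  assumes "continuous_on UNIV f" and "\<And>x. f x \<noteq> 0"
  shows "(\<forall>x. f x < 0) \<or> (\<forall>x. f x > 0)"
proof (rule ccontr)
  assume "\<not> ?thesis"
  then obtain a b where "f a \<ge> 0" "f b \<le> 0" by (auto simp: not_less)
  moreover have "connected (range f)"
    using assms(1) connected_UNIV by (rule connected_continuous_image)
  ultimately have "0 \<in> range f" by (meson connectedD_interval rangeI)
  then show False using assms(2) by fastforce
qed

section \<open>Angle coordinates on the orbits of a twist map\<close>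

locale torus_twist =
  fixes T :: "real \<times> real \<Rightarrow> real \<times> real"
  assumes TQ: "T \<in> TQ"
begin

lemma translate: "T (x + of_int a, y + of_int b) =
    (fst (T (x, y)) + of_int a + of_int b, snd (T (x, y)) + of_int b)"
  using TQ_periodic[OF TQ] by (simp add: prod_eq_iff)

lemma bij: "bij T"
  using TQ by (simp add: TQ_def C1_diffeo_plane_def)

lemma differentiable: "T differentiable (at z)"
  using TQ unfolding TQ_def C1_diffeo_plane_def C1_on_def differentiable_def by blast

lemma continuous_on: "continuous_on S T"
  by (intro continuous_at_imp_continuous_on ballI differentiable_imp_continuous_within
      differentiable)

lemma continuous_on_compose: "continuous_on S f \<Longrightarrow> continuous_on S (\<lambda>x. T (f x))"
  using continuous_on_compose2[OF continuous_on[of UNIV]] by blast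

text \<open>Positivity of \<open>deriv\<close> yields monotonicity only once the derivative is known
  to exist, which follows from the differentiability of \<open>T\<close>.\<close>

lemma twist: "I < J \<Longrightarrow> fst (T (x, I)) < fst (T (x, J))"
proof (erule DERIV_pos_imp_increasing)
  fix t
  have "(\<lambda>t. T (x, t)) differentiable (at t)"
    using differentiable_chain_at[of "\<lambda>t. (x, t)" t T] differentiable
    by (simp add: o_def differentiable_Pair)
  then have "(\<lambda>t. fst (T (x, t))) differentiable (at t)"
    by (auto simp: differentiable_def intro: has_derivative_fst)
  then have "((\<lambda>t. fst (T (x, t))) has_real_derivative deriv (\<lambda>t. fst (T (x, t))) t) (at t)"
    by (simp add: DERIV_deriv_iff_real_differentiable)
  moreover have "deriv (\<lambda>t. fst (T (x, t))) t > 0"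
    using TQ by (simp add: TQ_def)
  ultimately show "\<exists>y. ((\<lambda>t. fst (T (x, t))) has_real_derivative y) (at t) \<and> 0 < y" by blast
qed

text \<open>Integer heights shift the angle of the image by the same integer, so the intermediate
  value theorem applies between two of them.\<close>

lemma fst_surj: "\<exists>I. fst (T (x, I)) = x'"
proof -
  define c where "c = x' - fst (T (x, 0))"
  have fst_int: "fst (T (x, of_int m)) = fst (T (x, 0)) + of_int m" for m
    using translate[of x 0 0 m] by simp
  have "fst (T (x, of_int \<lfloor>c\<rfloor>)) \<le> x'" "x' \<le> fst (T (x, of_int \<lceil>c\<rceil>))"
    unfolding fst_int using of_int_floor_le[of c] le_of_int_ceiling[of c] c_def by linarith+
  moreover have "continuous_on {of_int \<lfloor>c\<rfloor>..of_int \<lceil>c\<rceil>} (\<lambda>I. fst (T (x, I)))"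
    by (intro continuous_on_fst continuous_on_compose continuous_intros)
  ultimately show ?thesis
    using IVT'[of "\<lambda>I. fst (T (x, I))" "of_int \<lfloor>c\<rfloor>" x' "of_int \<lceil>c\<rceil>"]
      floor_le_ceiling[of c] by auto
qed

text \<open>By the twist condition an orbit segment \<open>(\<phi>, I), (\<phi>', I')\<close> is determined by the angles
  \<open>\<phi>, \<phi>'\<close>; \<open>mom\<close> and \<open>mom'\<close> are \<open>I\<close> and \<open>I'\<close> as functions of them.\<close>

definition mom :: "real \<Rightarrow> real \<Rightarrow> real"
  where "mom x x' = (THE I. fst (T (x, I)) = x')"

definition mom' :: "real \<Rightarrow> real \<Rightarrow> real"
  where "mom' x x' = snd (T (x, mom x x'))"

lemma twist_iff: "fst (T (x, I)) < fst (T (x, J)) \<longleftrightarrow> I < J"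
  using twist[of I J x] twist[of J I x] by (cases I J rule: linorder_cases) auto

lemma fst_inj: "fst (T (x, I)) = fst (T (x, J)) \<longleftrightarrow> I = J"
  using twist[of I J x] twist[of J I x] by (cases I J rule: linorder_cases) auto

lemma mom_fst [simp]: "mom x (fst (T (x, I))) = I"
  unfolding mom_def by (rule the_equality) (auto simp: fst_inj)

lemma fst_mom [simp]: "fst (T (x, mom x x')) = x'"
  using fst_surj[of x x'] by auto

lemma T_mom: "T (x, mom x x') = (x', mom' x x')"
  by (simp add: mom'_def prod_eq_iff)

lemma mom'_fst: "mom' x (fst (T (x, I))) = snd (T (x, I))"
  by (simp add: mom'_def)

lemma mom_less_iff: "mom x y < mom x z \<longleftrightarrow> y < z"
  using twist_iff[of x "mom x y" "mom x z"] by simp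

text \<open>Translating the point by \<open>(a, b - a)\<close> moves the angle of its image by
  \<open>a + (b - a) = b\<close>.\<close>

lemma mom_translate: "mom (x + of_int a) (y + of_int b) = mom x y + of_int (b - a)"
proof -
  have "fst (T (x + of_int a, mom x y + of_int (b - a))) = y + of_int b"
    unfolding translate by simp
  then show ?thesis using mom_fst by metis
qed

lemma mom'_translate: "mom' (x + of_int a) (y + of_int b) = mom' x y + of_int (b - a)"
  unfolding mom'_def mom_translate translate by simp

lemma continuous_mom_left: "continuous_on UNIV (\<lambda>x. mom x y)"
  by (rule continuous_on_implicit_root[where F = "\<lambda>x I. fst (T (x, I)) - y"])
     (auto intro!: continuous_on_diff continuous_on_fst continuous_on_compose continuous_intros twist)

lemma continuous_mom_right: "continuous_on UNIV (\<lambda>y. mom x y)"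
  by (rule continuous_on_implicit_root[where F = "\<lambda>y I. fst (T (x, I)) - y"])
     (auto intro!: continuous_intros twist)

lemma continuous_mom_diag: "continuous_on UNIV (\<lambda>x. mom x x)"
  by (rule continuous_on_implicit_root[where F = "\<lambda>x I. fst (T (x, I)) - x"])
     (auto intro!: continuous_on_diff continuous_on_fst continuous_on_compose continuous_intros twist)

text \<open>Injectivity of \<open>T\<close> makes \<open>mom'\<close> injective in its first
  argument, hence strictly monotone by continuity. The drop under integer translation decides the
  direction.\<close>

lemma mom'_less:
  assumes "x < x'"
  shows "mom' x' y < mom' x y"
proof -
  define f where "f = (\<lambda>x. mom' x y)"
  \<comment> \<open>An integer translate of \<open>x\<close> beyond \<open>x'\<close>, where
    \<open>f\<close> is known exactly.\<close>
  define b where "b = x + of_int (\<lfloor>x' - x\<rfloor> + 1)"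
  have "x' < b" unfolding b_def by linarith
  have fb: "f b = f x - of_int (\<lfloor>x' - x\<rfloor> + 1)"
    unfolding f_def b_def using mom'_translate[of x "\<lfloor>x' - x\<rfloor> + 1" y 0] by simp
  have "f b < f x"
    unfolding fb using \<open>x < x'\<close> by linarith
  have "continuous_on S f" for S
    unfolding f_def mom'_def
    by (intro continuous_on_snd continuous_on_compose continuous_on_Pair continuous_on_id
        continuous_on_subset[OF continuous_mom_left] subset_UNIV)
  moreover have "inj_on f S" for S
  proof (rule inj_onI)
    fix s t assume "f s = f t"
    then have "T (s, mom s y) = T (t, mom t y)" by (simp add: T_mom f_def)
    then show "s = t" using bij by (simp add: bij_def inj_eq)
  qed
  ultimately have "(f x < f x' \<and> f x' < f b) \<or> (f b < f x' \<and> f x' < f x)"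
    using \<open>x < x'\<close> \<open>x' < b\<close> by (intro continuous_inj_imp_mono)
  then show ?thesis using \<open>f b < f x\<close> by (auto simp: f_def)
qed

lemma mom'_less_iff: "mom' x' y < mom' x y \<longleftrightarrow> x < x'"
  using mom'_less[of x x' y] mom'_less[of x' x y] by (cases x x' rule: linorder_cases) auto

text \<open>The height at which an orbit leaves \<open>b\<close> towards \<open>c\<close> minus the
  height at which it reaches \<open>b\<close> from \<open>a\<close>; it vanishes exactly when the
  two segments fit together.\<close>

definition defect :: "real \<Rightarrow> real \<Rightarrow> real \<Rightarrow> real"
  where "defect a b c = mom b c - mom' a b"

sublocale monotone_recurrence defect
proof
  show "defect a b c \<le> defect a' b c'" if "a \<le> a'" "c \<le> c'" for a a' b c c'
  proof -
    have "mom b c \<le> mom b c'" using that(2) by (simp add: mom_less_iff flip: not_less)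
    moreover have "mom' a' b \<le> mom' a b" using that(1) by (simp add: mom'_less_iff flip: not_less)
    ultimately show ?thesis by (simp add: defect_def)
  qed
  show "continuous_on UNIV (\<lambda>b. defect a b c)" for a c
    unfolding defect_def mom'_def
    by (intro continuous_on_diff continuous_mom_left continuous_on_snd continuous_on_compose
        continuous_on_Pair continuous_on_const continuous_mom_right)
  show "defect (a + of_int p) (b + of_int q) (c + of_int r) =
      defect a b c + of_int (p + r - 2 * q)" for a b c p q r
    unfolding defect_def mom_translate mom'_translate by simp
qed

text \<open>The points of fixed angle form a graph whose image is again a graph. If the two were
  disjoint, one would lie strictly above the other, and the regions below them would differ by a
  strip of positive measure on one side only.\<close>

lemma exact_fixed_angle:
  assumes mu: "positive_ac_measure \<mu>" and exact: "mu_exact \<mu> (cyl_map T)"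
  obtains \<phi> where "mom \<phi> \<phi> = mom' \<phi> \<phi>"
proof (rule ccontr)
  assume "\<not> thesis"
  then have ne: "mom' \<phi> \<phi> - mom \<phi> \<phi> \<noteq> 0" for \<phi> using that[of \<phi>] by auto
  have cont': "continuous_on UNIV (\<lambda>\<phi>. mom' \<phi> \<phi>)"
    unfolding mom'_def
    by (intro continuous_on_snd continuous_on_compose continuous_on_Pair continuous_on_id
        continuous_mom_diag)
  obtain G where G: "continuous_on UNIV G" "\<And>\<phi>. G (circle_of \<phi>) = mom \<phi> \<phi>"
    by (rule circle_descent[OF continuous_mom_diag]) (simp_all add: mom_translate)
  obtain H where H: "continuous_on UNIV H" "\<And>\<phi>. H (circle_of \<phi>) = mom' \<phi> \<phi>"
    by (rule circle_descent[OF cont']) (simp_all add: mom'_translate)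
  define A where "A = {p. snd p < G (fst p)}"
  define B where "B = {p. snd p < H (fst p)}"
  have cont_fst: "continuous_on UNIV (\<lambda>p :: circle \<times> real. G' (fst p))"
    if "continuous_on UNIV G'" for G' :: "circle \<Rightarrow> real"
    by (rule continuous_on_compose2[OF that continuous_on_fst[OF continuous_on_id]]) simp
  have "open A" "open B"
    unfolding A_def B_def
    by (intro open_Collect_less cont_fst G H continuous_on_snd continuous_on_id)+

  \<comment> \<open>For \<open>z\<close> with angle \<open>x\<close> and image of angle
    \<open>y\<close>, both memberships amount to \<open>y < x\<close>.\<close>
  have below: "T z \<in> cyl_proj -` B \<longleftrightarrow> z \<in> cyl_proj -` A" for z
  proof -
    obtain x I where z: "z = (x, I)" by force
    define y where "y = fst (T z)"
    have "I = mom x y" "T z = (y, mom' x y)" by (simp_all add: y_def z prod_eq_iff mom'_fst)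
    then show ?thesis
      by (simp add: A_def B_def cyl_proj_def z G H mom_less_iff mom'_less_iff)
  qed
  have lift: "cyl_map T (cyl_proj z) = cyl_proj (T z)" for z
    using TQ_is_lift_cyl_map[OF TQ] unfolding is_lift_def by metis
  have image: "cyl_map T ` A = B"
  proof (intro equalityI subsetI)
    fix p assume "p \<in> cyl_map T ` A"
    then obtain q where "q \<in> A" "p = cyl_map T q" by blast
    then show "p \<in> B" using surjD[OF surj_cyl_proj, of q] below lift by auto
  next
    fix p assume "p \<in> B"
    obtain z where z: "p = cyl_proj (T z)"
      using surjD[OF surj_cyl_proj, of p] bij by (metis bij_pointE)
    then have "cyl_proj z \<in> A" using \<open>p \<in> B\<close> below[of z] by simp
    then show "p \<in> cyl_map T ` A" using z lift by (metis imageI)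
  qed
  have "emeasure \<mu> (cyl_map T ` A - A) = emeasure \<mu> (A - cyl_map T ` A)"
    using exact \<open>open A\<close> homeomorphic_cylinder_below_graph[OF G(1)]
    unfolding mu_exact_def A_def by blast
  then have eq: "emeasure \<mu> (B - A) = emeasure \<mu> (A - B)" by (simp add: image)
  have sets: "sets \<mu> = sets borel" and pos: "open U \<Longrightarrow> U \<noteq> {} \<Longrightarrow> emeasure \<mu> U > 0" for U
    using mu by (auto simp: positive_ac_measure_def)
  \<comment> \<open>The strip between two strictly ordered graphs contains a nonempty open
    set.\<close>
  have strip: "emeasure \<mu> (Q - P) > 0"
    if less: "\<And>\<theta>. P' \<theta> < Q' \<theta>" and cont: "continuous_on UNIV P'" "continuous_on UNIV Q'"
      and P: "P = {p. snd p < P' (fst p)}" and Q: "Q = {p. snd p < Q' (fst p)}"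
      and "open P" "open Q"
    for P' Q' :: "circle \<Rightarrow> real" and P Q
  proof -
    define U where "U = {p. P' (fst p) < snd p} \<inter> Q"
    have "open U"
      unfolding U_def using \<open>open Q\<close>
      by (intro open_Int open_Collect_less cont_fst cont continuous_on_snd continuous_on_id)
    moreover have "(circle_of 0, (P' (circle_of 0) + Q' (circle_of 0)) / 2) \<in> U"
      using less[of "circle_of 0"] by (simp add: U_def Q)
    ultimately have "0 < emeasure \<mu> U" using pos by blast
    also have "\<dots> \<le> emeasure \<mu> (Q - P)"
      by (rule emeasure_mono) (use \<open>open P\<close> \<open>open Q\<close> in \<open>auto simp: U_def P sets\<close>)
    finally show ?thesis .
  qed
  have on_circle: "(\<forall>\<phi>. R (circle_of \<phi>)) \<Longrightarrow> R \<theta>" for R \<theta>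
    using surjD[OF surj_circle_of, of \<theta>] by auto
  have "continuous_on UNIV (\<lambda>\<phi>. mom' \<phi> \<phi> - mom \<phi> \<phi>)"
    by (intro continuous_on_diff cont' continuous_mom_diag)
  from nonzero_continuous_sign[OF this ne] show False
  proof
    assume "\<forall>\<phi>. mom' \<phi> \<phi> - mom \<phi> \<phi> < 0"
    then have less: "H \<theta> < G \<theta>" for \<theta>
      by (intro on_circle[of "\<lambda>\<theta>. H \<theta> < G \<theta>"]) (simp add: G H)
    then have empty: "B - A = {}" by (force simp: A_def B_def dest: less_trans)
    then show False
      using strip[OF less H(1) G(1) B_def A_def \<open>open B\<close> \<open>open A\<close>] eq unfolding empty by simp
  next
    assume "\<forall>\<phi>. mom' \<phi> \<phi> - mom \<phi> \<phi> > 0"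
    then have less: "G \<theta> < H \<theta>" for \<theta>
      by (intro on_circle[of "\<lambda>\<theta>. G \<theta> < H \<theta>"]) (simp add: G H)
    then have empty: "A - B = {}" by (force simp: A_def B_def dest: less_trans)
    then show False
      using strip[OF less G(1) H(1) A_def B_def \<open>open A\<close> \<open>open B\<close>] eq unfolding empty by simp
  qed
qed

end

subsection \<open>Periodic orbits on the torus\<close>

lemma torus_proj_eq_iff:
  "torus_proj w = torus_proj z \<longleftrightarrow> (\<exists>a b. w = (fst z + of_int a, snd z + of_int b))"
proof
  assume "torus_proj w = torus_proj z"
  then have "fst w - fst z \<in> \<int>" "snd w - snd z \<in> \<int>"
    by (auto simp: torus_proj_def case_prod_unfold circle_of_eq_iff)
  then obtain a b where "fst w - fst z = of_int a" "snd w - snd z = of_int b"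
    by (auto elim!: Ints_cases)
  then show "\<exists>a b. w = (fst z + of_int a, snd z + of_int b)"
    by (intro exI[of _ a] exI[of _ b]) (simp add: prod_eq_iff)
qed (auto simp: torus_proj_def case_prod_unfold circle_of_eq_iff)

context torus_twist
begin

definition closes :: "nat \<Rightarrow> int \<Rightarrow> int \<Rightarrow> real \<times> real \<Rightarrow> bool"
  where "closes n s m z \<longleftrightarrow> (T ^^ n) z = (fst z + of_int s, snd z + of_int m)"

text \<open>The vertical shift \<open>b\<close> persists and adds \<open>b\<close> to the angle at
  every step.\<close>

lemma funpow_translate: "(T ^^ n) (x + of_int a, y + of_int b) =
    (fst ((T ^^ n) (x, y)) + of_int (a + int n * b), snd ((T ^^ n) (x, y)) + of_int b)"
proof (induction n)
  case (Suc n)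
  show ?case
    using translate[of "fst ((T ^^ n) (x, y))" "a + int n * b" "snd ((T ^^ n) (x, y))" b]
    by (simp only: funpow.simps o_apply Suc.IH) (simp add: algebra_simps)
qed simp

lemma torus_map_funpow: "(torus_map T ^^ n) (torus_proj z) = torus_proj ((T ^^ n) z)"
proof (induction n)
  case (Suc n)
  have "torus_map T (torus_proj w) = torus_proj (T w)" for w
    using TQ_is_lift_torus_map[OF TQ] unfolding is_lift_def by metis
  with Suc show ?case by simp
qed simp

lemma closes_translate:
  assumes "closes n s m z"
  shows "closes n (s + int n * b) m (fst z + of_int a, snd z + of_int b)"
  using assms funpow_translate[of n "fst z" a "snd z" b] by (simp add: closes_def)

text \<open>Along the orbit \<open>n\<close> and \<open>m\<close> persist while the horizontal
  displacement grows by \<open>m\<close> per step, so \<open>s\<close> depends on the chosen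
  point.\<close>

lemma closes_orbit: "closes n s m z \<Longrightarrow> closes n (s + int i * m) m ((T ^^ i) z)"
proof (induction i)
  case (Suc i)
  define w where "w = (T ^^ i) z"
  have "(T ^^ n) (T w) = T ((T ^^ n) w)"
    by (metis funpow_swap1)
  also have "(T ^^ n) w = (fst w + of_int (s + int i * m), snd w + of_int m)"
    using Suc by (simp add: closes_def w_def)
  also have "T \<dots> = (fst (T w) + of_int (s + int (Suc i) * m), snd (T w) + of_int m)"
    unfolding translate by (simp add: algebra_simps)
  finally show ?case by (simp add: closes_def w_def)
qed simp

lemma closes_torus_orbit:
  assumes "closes n s m z" and "torus_proj w = (torus_map T ^^ i) (torus_proj z)"
  obtains s' where "closes n s' m w"
proof -
  obtain a b where w: "w = (fst ((T ^^ i) z) + of_int a, snd ((T ^^ i) z) + of_int b)"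
    using assms(2) unfolding torus_map_funpow torus_proj_eq_iff by blast
  show ?thesis
    using closes_translate[OF closes_orbit[OF assms(1), of i], of b a] that unfolding w by blast
qed

lemma closes_double:
  assumes "closes n s m z"
  shows "closes (2 * n) (2 * s + int n * m) (2 * m) z"
proof -
  have "(T ^^ (2 * n)) z = (T ^^ n) ((T ^^ n) z)"
    by (simp add: mult_2 funpow_add)
  also have "\<dots> = (T ^^ n) (fst z + of_int s, snd z + of_int m)"
    using assms by (simp add: closes_def)
  also have "\<dots> = (fst z + of_int (2 * s + int n * m), snd z + of_int (2 * m))"
    unfolding funpow_translate using assms by (simp add: closes_def)
  finally show ?thesis by (simp add: closes_def)
qed

text \<open>Without its linear drift the vertical displacement is periodic in time, hence bounded,
  and vanishes after division by time.\<close>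

lemma closes_rotation:
  assumes "closes n s m z" and "n \<ge> 1"
  shows "(\<lambda>j. (snd ((T ^^ j) z) - snd z) / real j) \<longlonglongrightarrow> of_int m / real n"
proof -
  define d where "d j = snd ((T ^^ j) z) - snd z - of_int m / real n * real j" for j
  have per: "d (j + n) = d j" for j
  proof -
    have "(T ^^ (j + n)) z = (T ^^ j) (fst z + of_int s, snd z + of_int m)"
      using assms(1) by (simp add: funpow_add closes_def)
    then have "snd ((T ^^ (j + n)) z) = snd ((T ^^ j) z) + of_int m"
      by (simp add: funpow_translate)
    then show ?thesis using \<open>n \<ge> 1\<close> by (simp add: d_def field_simps)
  qed
  have d_mod: "d j = d (j mod n)" for j
  proof -
    have "d (i + q * n) = d i" for i q
    proof (induction q)
      case (Suc q)
      then show ?case using per[of "i + q * n"] by (simp add: algebra_simps)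
    qed simp
    from this[of "j mod n" "j div n"] show ?thesis by (simp add: mult.commute)
  qed
  define C where "C = Max ((\<lambda>j. \<bar>d j\<bar>) ` {..<n})"
  have C: "\<bar>d j\<bar> \<le> C" for j
    unfolding d_mod[of j] C_def using \<open>n \<ge> 1\<close> by (intro Max_ge) auto
  have "(\<lambda>j. d j / real j) \<longlonglongrightarrow> 0"
  proof (rule Lim_null_comparison[OF always_eventually])
    show "\<forall>j. norm (d j / real j) \<le> C / real j"
      using C by (simp add: divide_right_mono)
  qed (rule lim_const_over_n)
  then have "(\<lambda>j. d j / real j + of_int m / real n) \<longlonglongrightarrow> 0 + of_int m / real n"
    by (intro tendsto_intros)
  then show ?thesis
    by (rule Lim_transform_eventually[THEN tendsto_eq_rhs])
       (auto intro!: eventually_sequentiallyI[of 1] simp: d_def field_simps)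
qed

text \<open>The closing time \<open>n\<close> is a multiple of the minimal period on the torus and
  may exceed it. The last conclusion retains \<open>n\<close> and \<open>m\<close> for all lifts of
  orbit points.\<close>

lemma closes_periodic_orbit:
  assumes z: "closes n s m z" and "n \<ge> 1"
  obtains Q where "periodic_orbit (torus_map T) Q" "torus_proj z \<in> Q"
    "orbit_has_vertical_rotation_number T Q (of_int m / real n)"
    "\<And>w. torus_proj w \<in> Q \<Longrightarrow> \<exists>s'. closes n s' m w"
proof -
  define x where "x = torus_proj z"
  define period where "period p \<longleftrightarrow> p \<ge> 1 \<and> (torus_map T ^^ p) x = x" for p
  define p where "p = (LEAST p. period p)"
  define Q where "Q = (\<lambda>i. (torus_map T ^^ i) x) ` {..<p}"
  have "period n"
    using z \<open>n \<ge> 1\<close> torus_proj_eq_iff unfolding period_def x_def torus_map_funpow closes_def by blast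
  then have "period p" unfolding p_def by (rule LeastI)
  moreover have "\<not> period q" if "q < p" for q
    using that not_less_Least unfolding p_def by blast
  ultimately have "periodic_orbit (torus_map T) Q"
    unfolding periodic_orbit_def Q_def period_def by blast
  moreover have "torus_proj z \<in> Q"
    using \<open>period p\<close> unfolding Q_def period_def x_def by (intro image_eqI[of _ _ 0]) auto
  moreover have closes: "\<exists>s'. closes n s' m w" if "torus_proj w \<in> Q" for w
    using that closes_torus_orbit[OF z] unfolding Q_def x_def by blast
  moreover have "orbit_has_vertical_rotation_number T Q (of_int m / real n)"
    unfolding orbit_has_vertical_rotation_number_def has_vertical_rotation_number_def
    using closes closes_rotation \<open>n \<ge> 1\<close> by blast
  ultimately show ?thesis using that by blast
qed

section \<open>Closing points and zeros of the defect\<close>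

lemma closes_imp_solution:
  assumes z: "closes n s m z"
  obtains u where "quasi_quadratic n s m u" "\<And>i. defect (u (i - 1)) (u i) (u (i + 1)) = 0"
proof -
  \<comment> \<open>The recurrence runs over all integers, so the orbit is continued backwards by
    \<open>inv T\<close>.\<close>
  define orb where "orb i = (if 0 \<le> i then (T ^^ nat i) z else (inv T ^^ nat (- i)) z)" for i
  have step: "T (orb i) = orb (i + 1)" for i
  proof (cases "0 \<le> i")
    case True
    then show ?thesis by (simp add: orb_def nat_add_distrib)
  next
    case False
    then have "nat (- i) = Suc (nat (- (i + 1)))" by simp
    then have "T (orb i) = (inv T ^^ nat (- (i + 1))) z"
      using False bij by (simp add: orb_def bij_is_surj surj_f_inv_f)
    also have "\<dots> = orb (i + 1)" using False by (cases "i = -1") (auto simp: orb_def)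
    finally show ?thesis .
  qed
  have shift: "orb (i + int n) = (fst (orb i) + of_int (s + i * m), snd (orb i) + of_int m)" for i
  proof (induction i rule: int_induct[where k = 0])
    case base
    then show ?case using z by (simp add: orb_def closes_def)
  next
    case (step1 i)
    have "orb (i + 1 + int n) = T (orb (i + int n))" by (simp add: step add_ac)
    also have "\<dots> = (fst (orb (i + 1)) + of_int (s + (i + 1) * m), snd (orb (i + 1)) + of_int m)"
      unfolding step1 translate by (simp add: step algebra_simps)
    finally show ?case .
  next
    case (step2 i)
    \<comment> \<open>Going down, the images under \<open>T\<close> are compared and
      \<open>T\<close> is cancelled by injectivity.\<close>
    have "T (orb (i - 1 + int n)) = orb (i + int n)" by (simp add: step algebra_simps)
    also have "\<dots> = T (fst (orb (i - 1)) + of_int (s + (i - 1) * m), snd (orb (i - 1)) + of_int m)"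
      unfolding step2 translate by (simp add: step algebra_simps)
    finally show ?case using bij by (simp add: bij_def inj_eq)
  qed
  define u where "u i = fst (orb i)" for i
  have mom: "mom (u i) (u (i + 1)) = snd (orb i)" and mom': "mom' (u i) (u (i + 1)) = snd (orb (i + 1))"
    for i
    using mom_fst[of "u i" "snd (orb i)"] mom'_fst[of "u i" "snd (orb i)"]
    by (simp_all add: u_def step)
  show ?thesis
  proof
    show "quasi_quadratic n s m u"
      by (simp add: quasi_quadratic_def u_def shift)
    show "defect (u (i - 1)) (u i) (u (i + 1)) = 0" for i
      using mom[of i] mom'[of "i - 1"] by (simp add: defect_def)
  qed
qed

text \<open>A vanishing defect makes the height of arrival at each angle the height of departure to
  the next, so the forward orbit of \<open>z\<close> follows \<open>w\<close>.\<close>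

lemma solution_imp_closes:
  assumes w: "quasi_quadratic N s k w" and sol: "\<And>i. defect (w (i - 1)) (w i) (w (i + 1)) = 0"
  obtains z where "closes N s k z"
proof
  define z where "z = (w 0, mom (w 0) (w 1))"
  have "(T ^^ n) z = (w (int n), mom (w (int n)) (w (int n + 1)))" for n
  proof (induction n)
    case (Suc n)
    then show ?case
      using sol[of "int n + 1"] by (simp add: T_mom defect_def add_ac)
  qed (simp add: z_def)
  moreover have "w (int N) = w 0 + of_int s" "w (int N + 1) = w 1 + of_int (s + k)"
    using w[unfolded quasi_quadratic_def, rule_format, of 0]
      w[unfolded quasi_quadratic_def, rule_format, of 1] by (simp_all add: add_ac)
  ultimately have "(T ^^ N) z = (w 0 + of_int s, mom (w 0) (w 1) + of_int (s + k - s))"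
    by (simp only: mom_translate)
  then show "closes N s k z" by (simp add: closes_def z_def)
qed

lemma closes_intermediate:
  assumes z: "closes n s m z" "n \<ge> 1" and z': "closes n' s' m' z'" "n' \<ge> 1" and "N \<ge> 1"
    and "of_int m / real n < of_int k / real N" "of_int k / real N < of_int m' / real n'"
  shows "\<exists>w. closes N r k w"
proof -
  obtain u where u: "quasi_quadratic n s m u" "\<And>i. defect (u (i - 1)) (u i) (u (i + 1)) = 0"
    using closes_imp_solution[OF z(1)] by metis
  obtain v where v: "quasi_quadratic n' s' m' v" "\<And>i. defect (v (i - 1)) (v i) (v (i + 1)) = 0"
    using closes_imp_solution[OF z'(1)] by metis
  obtain w where "quasi_quadratic N r k w" "\<And>i. defect (w (i - 1)) (w i) (w (i + 1)) = 0"
    using solution_exists[OF _ _ _ u v, of N k r] assms by auto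
  then show ?thesis using solution_imp_closes by metis
qed

text \<open>Horizontal displacements over \<open>2 * N\<close> steps of opposite parity separate the two orbits.\<close>

lemma two_periodic_orbits:
  assumes "N \<ge> 1" and ex: "\<And>n s m. n \<ge> 1 \<Longrightarrow> of_int m / real n = of_int k / real N \<Longrightarrow> \<exists>z. closes n s m z"
  obtains Q1 Q2 where "Q1 \<noteq> Q2"
    "periodic_orbit (torus_map T) Q1" "orbit_has_vertical_rotation_number T Q1 (of_int k / real N)"
    "periodic_orbit (torus_map T) Q2" "orbit_has_vertical_rotation_number T Q2 (of_int k / real N)"
proof -
  obtain z1 where z1: "closes N 0 k z1" using ex \<open>N \<ge> 1\<close> by blast
  \<comment> \<open>Running through a closing of \<open>N\<close> steps twice gives the displacement
    \<open>2 * s + int N * k\<close>, which never equals \<open>int N * k + 1\<close>.\<close>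
  obtain z2 where z2: "closes (2 * N) (int N * k + 1) (2 * k) z2"
    using ex[of "2 * N" "2 * k" "int N * k + 1"] \<open>N \<ge> 1\<close> by auto
  obtain Q1 where Q1: "periodic_orbit (torus_map T) Q1"
    "orbit_has_vertical_rotation_number T Q1 (of_int k / real N)"
    "\<And>w. torus_proj w \<in> Q1 \<Longrightarrow> \<exists>s. closes N s k w"
    using closes_periodic_orbit[OF z1 \<open>N \<ge> 1\<close>] by metis
  obtain Q2 where Q2: "periodic_orbit (torus_map T) Q2" "torus_proj z2 \<in> Q2"
    "orbit_has_vertical_rotation_number T Q2 (of_int (2 * k) / real (2 * N))"
    using closes_periodic_orbit[OF z2] \<open>N \<ge> 1\<close> by (metis mult_2 trans_le_add1)
  have "torus_proj z2 \<notin> Q1"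
  proof
    assume "torus_proj z2 \<in> Q1"
    then obtain s where "closes N s k z2" using Q1(3) by blast
    then have "closes (2 * N) (2 * s + int N * k) (2 * k) z2" by (rule closes_double)
    with z2 have "real_of_int (2 * s + int N * k) = real_of_int (int N * k + 1)"
      unfolding closes_def by simp
    then have "2 * s = 1" unfolding of_int_eq_iff by simp
    then show False by presburger
  qed
  then have "Q1 \<noteq> Q2" using Q2(2) by blast
  then show ?thesis using that Q1 Q2 by simp
qed

text \<open>A lift of an orbit point closes up to an integer vector, and uniqueness of limits
  identifies the rotation number.\<close>

lemma periodic_orbit_closes:
  assumes "periodic_orbit (torus_map T) Q" and "orbit_has_vertical_rotation_number T Q \<rho>"
  obtains n s m z where "n \<ge> 1" "closes n s m z" "\<rho> = of_int m / real n"
proof -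
  obtain x n where n: "n \<ge> 1" "(torus_map T ^^ n) x = x" "Q = (\<lambda>i. (torus_map T ^^ i) x) ` {..<n}"
    using assms(1) unfolding periodic_orbit_def by blast
  obtain z where z: "x = torus_proj z" using surjD[OF surj_torus_proj] by blast
  obtain s m where closes: "closes n s m z"
    using n(2) unfolding z torus_map_funpow torus_proj_eq_iff closes_def by blast
  have "x \<in> Q" unfolding n(3) using n(1) by (intro image_eqI[of _ _ 0]) auto
  then have "(\<lambda>j. (snd ((T ^^ j) z) - snd z) / real j) \<longlonglongrightarrow> \<rho>"
    using assms(2) z
    unfolding orbit_has_vertical_rotation_number_def has_vertical_rotation_number_def by blast
  then have "\<rho> = of_int m / real n"
    using closes_rotation[OF closes n(1)] by (rule LIMSEQ_unique)
  with n(1) closes show ?thesis by (rule that)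
qed

end

theorem theorem4:
  fixes T :: "real \<times> real \<Rightarrow> real \<times> real"
    and \<mu> :: "(circle \<times> real) measure"
    and k :: int and N :: nat
  assumes "T \<in> TQ"
    and "positive_ac_measure \<mu>"
    and "mu_exact \<mu> (cyl_map T)"
    and "k \<noteq> 0" and "N \<ge> 1"
    and "\<exists>Q. periodic_orbit (torus_map T) Q \<and>
          orbit_has_vertical_rotation_number T Q (real_of_int k / real N)"
  shows "\<forall>(k' :: int) (N' :: nat).
    k' \<noteq> 0 \<and> N' \<ge> 1 \<and>
    0 < \<bar>real_of_int k' / real N'\<bar> \<and>
    \<bar>real_of_int k' / real N'\<bar> < \<bar>real_of_int k / real N\<bar> \<and>
    k * k' > 0 \<longrightarrow>
    (\<exists>Q1 Q2. Q1 \<noteq> Q2 \<and>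
      periodic_orbit (torus_map T) Q1 \<and>
      orbit_has_vertical_rotation_number T Q1 (real_of_int k' / real N') \<and>
      periodic_orbit (torus_map T) Q2 \<and>
      orbit_has_vertical_rotation_number T Q2 (real_of_int k' / real N'))"
proof (intro allI impI, elim conjE)
  fix k' :: int and N' :: nat
  assume "N' \<ge> 1" and less: "\<bar>real_of_int k' / real N'\<bar> < \<bar>real_of_int k / real N\<bar>"
    and sign: "k * k' > 0"
  interpret torus_twist T by standard (rule assms(1))
  obtain n s m z where z: "n \<ge> 1" "closes n s m z" "real_of_int k / real N = of_int m / real n"
    using assms(6) periodic_orbit_closes by metis
  obtain \<phi> where "mom \<phi> \<phi> = mom' \<phi> \<phi>"
    by (rule exact_fixed_angle[OF assms(2,3)])
  \<comment> \<open>A point of fixed angle and fixed height is a fixed point of \<open>T\<close>; it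
    supplies the curvature \<open>0\<close>.\<close>
  then have z0: "closes 1 0 0 (\<phi>, mom \<phi> \<phi>)"
    using T_mom[of \<phi> \<phi>] by (simp add: closes_def)
  \<comment> \<open>All representations of the fraction are covered, since the second orbit uses the
    denominator \<open>2 * N'\<close>.\<close>
  have "\<exists>w. closes n' s' m' w"
    if "n' \<ge> 1" and eq: "of_int m' / real n' = of_int k' / real N'" for n' s' m'
  \<comment> \<open>The fixed point is the lower end of the range of curvatures for positive
    \<open>k\<close> and the upper end for negative \<open>k\<close>.\<close>
  proof (cases "k > 0")
    case True
    then have "k' > 0" using sign by (simp add: zero_less_mult_iff)
    then have "0 < real_of_int k' / real N'" "0 < real_of_int k / real N"
      using True \<open>N' \<ge> 1\<close> assms(5) by simp_all
    moreover from this have "real_of_int k' / real N' < of_int m / real n"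
      using less z(3) by linarith
    ultimately show ?thesis
      by (intro closes_intermediate[OF z0 order_refl z(2,1) that(1)]) (simp_all only: eq of_int_0 div_0)
  next
    case False
    then have "k < 0" "k' < 0" using sign by (auto simp: zero_less_mult_iff)
    then have neg: "real_of_int k' / real N' < 0" "real_of_int k / real N < 0"
      using \<open>N' \<ge> 1\<close> assms(5) by (auto simp: divide_neg_pos)
    then have "of_int m / real n < real_of_int k' / real N'"
      using less z(3) by linarith
    then show ?thesis
      using neg(1) by (intro closes_intermediate[OF z(2,1) z0 order_refl that(1)]) (simp_all only: eq of_int_0 div_0)
  qed
  from two_periodic_orbits[OF \<open>N' \<ge> 1\<close> this] show "\<exists>Q1 Q2. Q1 \<noteq> Q2 \<and>
      periodic_orbit (torus_map T) Q1 \<and>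
      orbit_has_vertical_rotation_number T Q1 (real_of_int k' / real N') \<and>
      periodic_orbit (torus_map T) Q2 \<and>
      orbit_has_vertical_rotation_number T Q2 (real_of_int k' / real N')"
    by metis
qed

end
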